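(* Let $D = K_4 - e$ be the diamond. For every $n$ with $4 \leq n \leq 10$, $rb(K_n,D) = ext(n,\{C_3,C_4\}) + 2$.
   Context: For a graph $H$ and an integer $n$, the rainbow number $rb(K_n,H)$ is the minimum number $m$ such that every edge-colouring of $K_n$ using at least $m$ colours contains a rainbow copy of $H$ (a subgraph isomorphic to $H$ whose edges all have distinct colours). For a family $\mathcal{H}$ of graphs, $ext(n,\mathcal{H})$ is the maximum number of edges in a graph on $n$ vertices containing no member of $\mathcal{H}$ as a subgraph. $C_k$ denotes the cycle on $k$ vertices. *)

theory Defs
  imports "HOL-Library.Ramsey"
begin

type_synonym 'a graph = "'a set \<times> 'a set set"

abbreviation verts :: "'a graph \<Rightarrow> 'a set" where
  "verts \<equiv> fst"

abbreviation edges :: "'a graph \<Rightarrow> 'a set set" where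
  "edges \<equiv> snd"

definition simple_graph :: "'a graph \<Rightarrow> bool" where
  "simple_graph G \<longleftrightarrow> finite (verts G) \<and> edges G \<subseteq> [verts G]\<^bsup>2\<^esup>"

definition subgraph :: "'a graph \<Rightarrow> 'a graph \<Rightarrow> bool" where
  "subgraph S G \<longleftrightarrow> simple_graph S \<and> verts S \<subseteq> verts G \<and> edges S \<subseteq> edges G"

definition isomorphic :: "'a graph \<Rightarrow> 'b graph \<Rightarrow> bool" where
  "isomorphic G H \<longleftrightarrow>
     (\<exists>f. bij_betw f (verts G) (verts H) \<and> (\<lambda>e. f ` e) ` edges G = edges H)"

definition contains_copy :: "'a graph \<Rightarrow> 'b graph \<Rightarrow> bool" where
  "contains_copy G H \<longleftrightarrow> (\<exists>S. subgraph S G \<and> isomorphic S H)"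

definition complete_graph :: "nat \<Rightarrow> nat graph" where
  "complete_graph n = ({..<n}, [{..<n}]\<^bsup>2\<^esup>)"

(* Only meaningful for k \<ge> 3. *)
definition cycle_graph :: "nat \<Rightarrow> nat graph" where
  "cycle_graph k = ({..<k}, {{i, (i + 1) mod k} | i. i < k})"

definition diamond :: "nat graph" where
  "diamond = (verts (complete_graph 4), edges (complete_graph 4) - {{0, 1}})"

(* An edge colouring of G is an arbitrary function on vertex sets of which only the values on
   edges G matter; the number of colours it uses on G is card (c ` edges G).
   Since graphs are finite, taking the colours in nat loses no generality. *)

definition rainbow :: "('a set \<Rightarrow> nat) \<Rightarrow> 'a graph \<Rightarrow> bool" where
  "rainbow c G \<longleftrightarrow> inj_on c (edges G)"

definition contains_rainbow_copy :: "('a set \<Rightarrow> nat) \<Rightarrow> 'a graph \<Rightarrow> 'b graph \<Rightarrow> bool" where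
  "contains_rainbow_copy c G H \<longleftrightarrow> (\<exists>S. subgraph S G \<and> isomorphic S H \<and> rainbow c S)"

(* The set of admissible m is never empty: once m exceeds the number of edges of K_n,
   no colouring uses at least m colours. *)
definition rb :: "nat \<Rightarrow> 'b graph \<Rightarrow> nat" where
  "rb n H = (LEAST m. \<forall>c :: nat set \<Rightarrow> nat.
      m \<le> card (c ` edges (complete_graph n)) \<longrightarrow> contains_rainbow_copy c (complete_graph n) H)"

(* Up to isomorphism the vertex set of a graph on n vertices may be taken to be {..<n}.
   Max ranges over a finite set, nonempty as soon as every member of F has an edge. *)
definition ext :: "nat \<Rightarrow> 'b graph set \<Rightarrow> nat" where
  "ext n F = Max {card (edges G) | G :: nat graph.
      simple_graph G \<and> verts G = {..<n} \<and> (\<forall>H\<in>F. \<not> contains_copy G H)}"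

end

theory Submission
  imports Defs
begin

text \<open>Deleting any edge of the diamond leaves a triangle or a 4-cycle, so giving the edges of an
  extremal graph distinct colours and all other edges one further colour avoids a rainbow diamond;
  this is the lower bound. Conversely, a colouring has a rainbow diamond iff some four vertices span
  at least five colours. If none do, delete each vertex v in turn and count the colours lost: a
  colour is lost at v iff v meets all of its edges, so it is lost for at most two vertices, and for
  two only if it occurs on a single edge. Hence k colours on n vertices satisfy
  n * (k - g) <= 2 * k, where g bounds the number of colours on n - 1 vertices (with 2 * k - 2 on
  the right when there are more than k + n - 2 edges). Starting from four colours on four vertices this
  gives 6, 9, 11, 13, 16 colours for 5, 7, 8, 9, 10 vertices. For six vertices the bound 7 needs one
  more observation: if two colours are lost at v, on edges vi and vj, then no triangle on ij avoiding
  v is rainbow, which forces at most 5 colours outside v. Finally, the Petersen graph has induced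
  subgraphs of girth at least 5 with exactly one edge less than these bounds.\<close>

subsection \<open>Colours lost by deleting a vertex\<close>

definition cols :: "('a set \<Rightarrow> 'b) \<Rightarrow> 'a set \<Rightarrow> 'b set" where
  "cols c V = c ` [V]\<^bsup>2\<^esup>"

lemma cols_empty [simp]: "cols c {} = {}"
  by (auto simp: cols_def nsets_def)

lemma nsets_2_insert:
  "a \<notin> A \<Longrightarrow> [insert a A]\<^bsup>2\<^esup> = (\<lambda>u. {a, u}) ` A \<union> [A]\<^bsup>2\<^esup>"
  by (auto simp: nsets_2_eq doubleton_eq_iff)

lemma cols_insert:
  "a \<notin> A \<Longrightarrow> cols c (insert a A) = (\<lambda>u. c {a, u}) ` A \<union> cols c A"
  by (simp add: cols_def nsets_2_insert image_Un image_image)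

lemma finite_cols: "finite V \<Longrightarrow> finite (cols c V)"
  by (simp add: cols_def finite_imp_finite_nsets)

lemma cols_mono: "A \<subseteq> B \<Longrightarrow> cols c A \<subseteq> cols c B"
  unfolding cols_def by (intro image_mono nsets_mono)

text \<open>For a colour that occurs in \<open>V\<close>, these are the vertices common to all its
  edges: two if it sits on a single edge, one if its class is a star of several edges, none
  otherwise. For a colour that does not occur the set is all of \<open>V\<close>, so the counting
  lemmas assume \<open>\<gamma> \<in> cols c V\<close>.\<close>

definition centres :: "('a set \<Rightarrow> 'b) \<Rightarrow> 'a set \<Rightarrow> 'b \<Rightarrow> 'a set" where
  "centres c V \<gamma> = {v \<in> V. \<gamma> \<notin> cols c (V - {v})}"

text \<open>An edge that avoids \<open>v\<close> survives the deletion of \<open>v\<close> and keeps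
  its colour alive.\<close>

lemma centres_subset:
  assumes "e \<in> [V]\<^bsup>2\<^esup>"
  shows "centres c V (c e) \<subseteq> e"
proof
  fix v assume v: "v \<in> centres c V (c e)"
  show "v \<in> e"
  proof (rule ccontr)
    assume "v \<notin> e"
    then have "e \<in> [V - {v}]\<^bsup>2\<^esup>" using assms by (auto simp: nsets_def)
    then show False using v by (auto simp: centres_def cols_def)
  qed
qed

lemma card_centres_le_2:
  assumes "\<gamma> \<in> cols c V"
  shows "card (centres c V \<gamma>) \<le> 2"
proof -
  obtain e where e: "e \<in> [V]\<^bsup>2\<^esup>" and \<gamma>: "\<gamma> = c e" using assms by (auto simp: cols_def)
  then have "finite e" "card e = 2" by (auto simp: nsets_def)
  then show ?thesis using card_mono[OF _ centres_subset[OF e]] \<gamma> by simp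
qed

text \<open>One formula for two cases: two centres force a single edge, and one centre
  \<open>v\<close> puts the class inside the star at \<open>v\<close>, which has
  \<open>card V - 1\<close> edges. The factor \<open>2 - card (centres c V \<gamma>)\<close> is the
  shortfall that is summed over all colours later.\<close>

lemma card_colour_class_le:
  assumes V: "finite V" and \<gamma>: "\<gamma> \<in> cols c V" and ne: "centres c V \<gamma> \<noteq> {}"
  shows "card {e \<in> [V]\<^bsup>2\<^esup>. c e = \<gamma>} \<le> 1 + (card V - 2) * (2 - card (centres c V \<gamma>))"
proof (cases "card (centres c V \<gamma>) = 2")
  case True
  \<comment> \<open>Both centres lie on every edge of the class, and an edge has only two
    vertices.\<close>
  have "e = centres c V \<gamma>" if "e \<in> [V]\<^bsup>2\<^esup>" "c e = \<gamma>" for e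
  proof -
    have "finite e" "card e = 2" using that by (auto simp: nsets_def)
    then show ?thesis using card_subset_eq[OF _ centres_subset[OF that(1), of c]] True that(2) by simp
  qed
  then have "{e \<in> [V]\<^bsup>2\<^esup>. c e = \<gamma>} \<subseteq> {centres c V \<gamma>}" by auto
  then have "card {e \<in> [V]\<^bsup>2\<^esup>. c e = \<gamma>} \<le> 1" using card_mono[of "{centres c V \<gamma>}"] by simp
  then show ?thesis by simp
next
  case False
  have fin: "finite (centres c V \<gamma>)" using V by (simp add: centres_def)
  have one: "card (centres c V \<gamma>) = 1"
    using False card_centres_le_2[OF \<gamma>] ne fin card_gt_0_iff[of "centres c V \<gamma>"] by linarith
  obtain v where v: "v \<in> centres c V \<gamma>" using ne by auto
  have vV: "v \<in> V" using v by (simp add: centres_def)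
  have "{e \<in> [V]\<^bsup>2\<^esup>. c e = \<gamma>} \<subseteq> (\<lambda>u. {v, u}) ` (V - {v})"
  proof
    fix e assume "e \<in> {e \<in> [V]\<^bsup>2\<^esup>. c e = \<gamma>}"
    then have e: "e \<in> [V]\<^bsup>2\<^esup>" and "c e = \<gamma>" by auto
    then have "v \<in> e" using centres_subset[OF e, of c] v by auto
    then show "e \<in> (\<lambda>u. {v, u}) ` (V - {v})"
      using e by (auto simp: nsets_2_eq)
  qed
  then have "card {e \<in> [V]\<^bsup>2\<^esup>. c e = \<gamma>} \<le> card (V - {v})"
    using surj_card_le V by blast
  also have "\<dots> = card V - 1" using vV V by simp
  finally show ?thesis using one by simp
qed

text \<open>Double counting of the pairs of a vertex and a colour lost there: at each vertex, lost
  and surviving colours together make up \<open>cols c V\<close>.\<close>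

lemma sum_exclusive_colours:
  assumes V: "finite V"
  shows "card V * card (cols c V)
    = (\<Sum>\<gamma>\<in>cols c V. card (centres c V \<gamma>)) + (\<Sum>v\<in>V. card (cols c (V - {v})))"
proof -
  let ?C = "cols c V"
  have C: "finite ?C" by (rule finite_cols[OF V])
  have "(\<Sum>\<gamma>\<in>?C. card (centres c V \<gamma>)) = (\<Sum>\<gamma>\<in>?C. \<Sum>v\<in>V. of_bool (\<gamma> \<notin> cols c (V - {v})))"
    using V by (simp add: centres_def Int_def)
  also have "\<dots> = (\<Sum>v\<in>V. \<Sum>\<gamma>\<in>?C. of_bool (\<gamma> \<notin> cols c (V - {v})))"
    by (rule sum.swap)
  also have "\<dots> = (\<Sum>v\<in>V. card (?C - cols c (V - {v})))"
    using C by (intro sum.cong) (auto simp: set_diff_eq Int_def)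
  finally have "(\<Sum>\<gamma>\<in>?C. card (centres c V \<gamma>)) + (\<Sum>v\<in>V. card (cols c (V - {v})))
      = (\<Sum>v\<in>V. card (?C - cols c (V - {v})) + card (cols c (V - {v})))"
    by (simp add: sum.distrib)
  also have "\<dots> = (\<Sum>v\<in>V. card ?C)"
  proof (rule sum.cong)
    fix v
    have sub: "cols c (V - {v}) \<subseteq> ?C" by (rule cols_mono) auto
    show "card (?C - cols c (V - {v})) + card (cols c (V - {v})) = card ?C"
      using card_Diff_subset[OF finite_subset[OF sub C] sub] card_mono[OF C sub] by simp
  qed simp
  finally show ?thesis by simp
qed

lemma card_cols_le_sum_delete:
  assumes "finite V"
  shows "card V * card (cols c V) \<le> 2 * card (cols c V) + (\<Sum>v\<in>V. card (cols c (V - {v})))"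
proof -
  have "(\<Sum>\<gamma>\<in>cols c V. card (centres c V \<gamma>)) \<le> card (cols c V) * 2"
    by (metis sum_bounded_above card_centres_le_2 of_nat_id)
  then show ?thesis using sum_exclusive_colours[OF assms, of c] by simp
qed

text \<open>The 2 gained is the total shortfall of the colours from having two centres each. If it
  were at most 1, at most one colour would repeat, on a star of at most \<open>card V - 1\<close>
  edges, so there would be at most \<open>card (cols c V) + (card V - 2)\<close> edges, against
  \<open>few\<close>.\<close>

lemma card_cols_le_sum_delete_strong:
  assumes V: "finite V" and few: "card (cols c V) + (card V - 2) < card V choose 2"
  shows "card V * card (cols c V) + 2
    \<le> 2 * card (cols c V) + (\<Sum>v\<in>V. card (cols c (V - {v})))"
proof -
  let ?C = "cols c V" and ?w = "\<lambda>\<gamma>. card (centres c V \<gamma>)"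
  have C: "finite ?C" by (rule finite_cols[OF V])
  have w2: "?w \<gamma> \<le> 2" if "\<gamma> \<in> ?C" for \<gamma> using card_centres_le_2[OF that] .
  have defect: "(\<Sum>\<gamma>\<in>?C. ?w \<gamma>) + (\<Sum>\<gamma>\<in>?C. 2 - ?w \<gamma>) = 2 * card ?C"
  proof -
    have "(\<Sum>\<gamma>\<in>?C. ?w \<gamma>) + (\<Sum>\<gamma>\<in>?C. 2 - ?w \<gamma>) = (\<Sum>\<gamma>\<in>?C. 2)"
      using w2 by (simp flip: sum.distrib)
    then show ?thesis by simp
  qed
  have "2 \<le> (\<Sum>\<gamma>\<in>?C. 2 - ?w \<gamma>)"
  proof (cases "\<exists>\<gamma>\<in>?C. centres c V \<gamma> = {}")
    case True
    \<comment> \<open>A colour without a centre has shortfall 2 on its own.\<close>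
    then obtain \<gamma> where "\<gamma> \<in> ?C" "?w \<gamma> = 0" by auto
    then show ?thesis using member_le_sum[of \<gamma> ?C "\<lambda>\<gamma>. 2 - ?w \<gamma>"] C by simp
  next
    case False
    have "[V]\<^bsup>2\<^esup> = (\<Union>\<gamma>\<in>?C. {e \<in> [V]\<^bsup>2\<^esup>. c e = \<gamma>})" by (auto simp: cols_def)
    then have "card V choose 2 \<le> (\<Sum>\<gamma>\<in>?C. card {e \<in> [V]\<^bsup>2\<^esup>. c e = \<gamma>})"
      using C card_UN_le[of ?C "\<lambda>\<gamma>. {e \<in> [V]\<^bsup>2\<^esup>. c e = \<gamma>}"] by (metis card_nsets)
    also have "\<dots> \<le> (\<Sum>\<gamma>\<in>?C. 1 + (card V - 2) * (2 - ?w \<gamma>))"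
      using False by (intro sum_mono card_colour_class_le V) auto
    also have "\<dots> = card ?C + (card V - 2) * (\<Sum>\<gamma>\<in>?C. 2 - ?w \<gamma>)"
      by (simp only: sum.distrib sum_distrib_left) simp
    finally have "(card V - 2) * 1 < (card V - 2) * (\<Sum>\<gamma>\<in>?C. 2 - ?w \<gamma>)"
      using few by linarith
    then show ?thesis using mult_less_cancel1 by fastforce
  qed
  then show ?thesis using sum_exclusive_colours[OF V, of c] defect by linarith
qed

section \<open>Five vertices with no rainbow triangle over one edge\<close>

lemma card_insert_le_Suc: "finite A \<Longrightarrow> card (insert a A) \<le> Suc (card A)"
  by (rule card_insert_le_m1) auto

text \<open>For each of \<open>x\<close>, \<open>y\<close>, \<open>z\<close> pick an alternative of
  \<open>tri\<close> that holds. With three vertices, one of the first two alternatives is picked at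
  most once. If it is \<open>c {i, j} = c {i, k}\<close>, then all colours on \<open>ij\<close> and
  between \<open>j\<close> and \<open>x\<close>, \<open>y\<close>, \<open>z\<close> occur between
  \<open>i\<close> and \<open>x\<close>, \<open>y\<close>, \<open>z\<close>, except for one colour
  at most; so \<open>j\<close> adds at most one colour to the four on \<open>{i, x, y, z}\<close>.
  The other case is symmetric.\<close>

lemma card_cols_5_le_5:
  assumes d: "distinct [i, j, x, y, z]"
    and four: "\<And>X. X \<subseteq> {i, j, x, y, z} \<Longrightarrow> card X = 4 \<Longrightarrow> card (cols c X) \<le> 4"
    and tri: "\<And>k. k \<in> {x, y, z} \<Longrightarrow>
      c {i, j} = c {i, k} \<or> c {i, j} = c {j, k} \<or> c {i, k} = c {j, k}"
  shows "card (cols c {i, j, x, y, z}) \<le> 5"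
proof -
  have cols4: "cols c {s, x, y, z} = {c {s, x}, c {s, y}, c {s, z}} \<union> cols c {x, y, z}"
    if "s \<in> {i, j}" for s
    using that d cols_insert[of s "{x, y, z}" c] by auto
  have all: "cols c {i, j, x, y, z} = {c {i, j}, c {i, x}, c {i, y}, c {i, z}} \<union>
      ({c {j, x}, c {j, y}, c {j, z}} \<union> cols c {x, y, z})"
    using d cols_insert[of i "{j, x, y, z}" c] cols4[of j] by auto
  \<comment> \<open>The witness is the colour of the one exceptional edge \<open>jk\<close> or
    \<open>ik\<close>, or \<open>c {i, j}\<close> if there is none; all seven candidates are
    tried.\<close>
  have "\<exists>\<gamma>. {c {i, j}, c {j, x}, c {j, y}, c {j, z}} \<subseteq> {\<gamma>, c {i, x}, c {i, y}, c {i, z}} \<or>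
      {c {i, j}, c {i, x}, c {i, y}, c {i, z}} \<subseteq> {\<gamma>, c {j, x}, c {j, y}, c {j, z}}"
    using tri[of x, simplified] tri[of y, simplified] tri[of z, simplified]
    by (elim disjE)
      ((rule exI[of _ "c {i, j}"], simp; fail) | (rule exI[of _ "c {i, x}"], simp; fail) |
       (rule exI[of _ "c {i, y}"], simp; fail) | (rule exI[of _ "c {i, z}"], simp; fail) |
       (rule exI[of _ "c {j, x}"], simp; fail) | (rule exI[of _ "c {j, y}"], simp; fail) |
       (rule exI[of _ "c {j, z}"], simp; fail))+
  then have "\<exists>s\<in>{i, j}. \<exists>\<gamma>. cols c {i, j, x, y, z} \<subseteq> insert \<gamma> (cols c {s, x, y, z})"
  proof (elim exE disjE)
    fix \<gamma>
    assume "{c {i, j}, c {j, x}, c {j, y}, c {j, z}} \<subseteq> {\<gamma>, c {i, x}, c {i, y}, c {i, z}}"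
    then have "cols c {i, j, x, y, z} \<subseteq> insert \<gamma> (cols c {i, x, y, z})"
      unfolding all cols4[of i, simplified] by blast
    then show ?thesis by blast
  next
    fix \<gamma>
    assume "{c {i, j}, c {i, x}, c {i, y}, c {i, z}} \<subseteq> {\<gamma>, c {j, x}, c {j, y}, c {j, z}}"
    then have "cols c {i, j, x, y, z} \<subseteq> insert \<gamma> (cols c {j, x, y, z})"
      unfolding all cols4[of j, simplified] by blast
    then show ?thesis by blast
  qed
  then obtain s \<gamma> where s: "s \<in> {i, j}"
    and sub: "cols c {i, j, x, y, z} \<subseteq> insert \<gamma> (cols c {s, x, y, z})" by blast
  have fin: "finite (cols c {s, x, y, z})" by (simp add: finite_cols)
  have "card (cols c {s, x, y, z}) \<le> 4" using s d by (intro four) auto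
  then have "card (insert \<gamma> (cols c {s, x, y, z})) \<le> 5"
    using card_insert_le_Suc[OF fin, of \<gamma>] by linarith
  moreover have "card (cols c {i, j, x, y, z}) \<le> card (insert \<gamma> (cols c {s, x, y, z}))"
    using fin sub by (intro card_mono) auto
  ultimately show ?thesis by linarith
qed

subsection \<open>Colourings in which four vertices span at most four colours\<close>

text \<open>This says that \<open>V\<close> has no rainbow diamond, without mentioning copies: a
  rainbow diamond shows five colours on four vertices, and \<open>contains_rainbow_diamondI\<close>
  gives the converse.\<close>

definition quad_bounded :: "('a set \<Rightarrow> 'b) \<Rightarrow> 'a set \<Rightarrow> bool" where
  "quad_bounded c V \<longleftrightarrow> (\<forall>X\<subseteq>V. card X = 4 \<longrightarrow> card (cols c X) \<le> 4)"

lemma quad_bounded_mono: "quad_bounded c V \<Longrightarrow> W \<subseteq> V \<Longrightarrow> quad_bounded c W"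
  by (auto simp: quad_bounded_def)

text \<open>With \<open>n = Suc m\<close> vertices and \<open>k\<close> colours, the first bound
  reads (n - 2) * k \<le> n * g; the second improves it by 2, and \<open>m - 1\<close> there is
  \<open>card V - 2\<close>.\<close>

lemma card_cols_deletion:
  assumes V: "card V = Suc m"
    and g: "\<And>v. v \<in> V \<Longrightarrow> card (cols c (V - {v})) \<le> g"
  shows "Suc m * card (cols c V) \<le> 2 * card (cols c V) + Suc m * g"
    and "card (cols c V) + (m - 1) < Suc m choose 2 \<Longrightarrow>
      Suc m * card (cols c V) + 2 \<le> 2 * card (cols c V) + Suc m * g"
proof -
  have fin: "finite V" using V card.infinite by fastforce
  have "(\<Sum>v\<in>V. card (cols c (V - {v}))) \<le> Suc m * g"
    using sum_bounded_above[of V _ g, OF g] V by simp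
  then show "Suc m * card (cols c V) \<le> 2 * card (cols c V) + Suc m * g"
    and "card (cols c V) + (m - 1) < Suc m choose 2 \<Longrightarrow>
      Suc m * card (cols c V) + 2 \<le> 2 * card (cols c V) + Suc m * g"
    using card_cols_le_sum_delete[OF fin, of c] card_cols_le_sum_delete_strong[OF fin, of c] V
    by simp_all
qed

lemma card_cols_5:
  assumes V: "card V = 5" and q: "quad_bounded c V"
  shows "card (cols c V) \<le> 6"
proof -
  have "card (cols c (V - {v})) \<le> 4" if "v \<in> V" for v
    using q that V by (auto simp: quad_bounded_def)
  then show ?thesis using card_cols_deletion(1)[of V 4 c 4] V by simp
qed

lemma card_cols_delete_le_5:
  assumes V: "card V = 6" and q: "quad_bounded c V" and v: "v \<in> V"
    and two: "card (cols c (V - {v})) + 2 \<le> card (cols c V)"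
  shows "card (cols c (V - {v})) \<le> 5"
proof -
  let ?W = "V - {v}" and ?D = "cols c V - cols c (V - {v})"
  have finV: "finite V" using V card.infinite by fastforce
  have ins: "insert v ?W = V" using v by auto
  have "card (cols c V) \<le> card ?D + card (cols c ?W)"
    by (metis add.commute diff_card_le_card_Diff finV finite_Diff finite_cols le_diff_conv)
  then have "2 \<le> card ?D" using two by linarith
  then obtain p r where pr: "p \<in> ?D" "r \<in> ?D" "p \<noteq> r"
    using card_le_Suc0_iff_eq[of ?D] finite_cols[OF finV, of c] by fastforce
  have D: "?D \<subseteq> (\<lambda>u. c {v, u}) ` ?W"
    using cols_insert[of v ?W c] ins by auto
  obtain i j where ij: "i \<in> ?W" "j \<in> ?W" "p = c {v, i}" "r = c {v, j}"
    using D pr by blast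
  have "i \<noteq> j" using ij pr(3) by auto
  have "card (?W - {i, j}) = 3" using ij \<open>i \<noteq> j\<close> V v finV by simp
  then obtain x y z where xyz: "?W - {i, j} = {x, y, z}" "distinct [x, y, z]"
    by (auto simp: card_3_iff)
  have W: "?W = {i, j, x, y, z}" using xyz(1) ij by auto
  have d: "distinct [i, j, x, y, z]" using xyz \<open>i \<noteq> j\<close> by auto
  have tri: "c {i, j} = c {i, k} \<or> c {i, j} = c {j, k} \<or> c {i, k} = c {j, k}"
    if k: "k \<in> {x, y, z}" for k
  proof (rule ccontr)
    assume neg: "\<not> ?thesis"
    have kW: "k \<in> ?W" and kij: "k \<noteq> i" "k \<noteq> j" using k W d by auto
    have "{c {i, j}, c {i, k}, c {j, k}} \<subseteq> cols c ?W"
      using ij kW kij \<open>i \<noteq> j\<close> unfolding cols_def by auto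
    \<comment> \<open>\<open>p\<close> and \<open>r\<close> are lost at \<open>v\<close>, so they
      differ from the triangle's colours, which lie inside \<open>?W\<close>.\<close>
    then have "distinct [p, r, c {i, j}, c {i, k}, c {j, k}]" using neg pr by auto
    from distinct_card[OF this] have five: "card {p, r, c {i, j}, c {i, k}, c {j, k}} = 5"
      by simp
    have "{p, r, c {i, j}, c {i, k}, c {j, k}} \<subseteq> cols c {v, i, j, k}"
      using ij kW kij \<open>i \<noteq> j\<close> by (auto simp: cols_insert)
    then have "5 \<le> card (cols c {v, i, j, k})"
      using five by (metis card_mono finite.emptyI finite.insertI finite_cols)
    moreover have "card (cols c {v, i, j, k}) \<le> 4"
      using q ij kW kij \<open>i \<noteq> j\<close> v by (auto simp: quad_bounded_def)
    ultimately show False by linarith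
  qed
  have "card (cols c {i, j, x, y, z}) \<le> 5"
  proof (rule card_cols_5_le_5[OF d _ tri])
    fix X assume "X \<subseteq> {i, j, x, y, z}" "card X = 4"
    then show "card (cols c X) \<le> 4" using q W unfolding quad_bounded_def by blast
  qed
  then show ?thesis using W by simp
qed

text \<open>The bound 6 on five vertices alone would only give 9. With eight colours at least two
  would be lost at every vertex, so every deletion would leave at most 5, and 6 * k \<le> 2 * k + 30
  would fail.\<close>

lemma card_cols_6:
  assumes V: "card V = 6" and q: "quad_bounded c V"
  shows "card (cols c V) \<le> 7"
proof (rule ccontr)
  assume big: "\<not> ?thesis"
  have "card (cols c (V - {v})) \<le> 5" if v: "v \<in> V" for v
  proof -
    have "card (cols c (V - {v})) \<le> 6"
      using v V by (intro card_cols_5 quad_bounded_mono[OF q]) auto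
    then show ?thesis using card_cols_delete_le_5[OF V q v] big by linarith
  qed
  then show False using card_cols_deletion(1)[of V 5 c 5] V big by simp
qed

lemma card_cols_7:
  assumes V: "card V = 7" and q: "quad_bounded c V"
  shows "card (cols c V) \<le> 9"
proof -
  have "card (cols c (V - {v})) \<le> 7" if "v \<in> V" for v
    using that V by (intro card_cols_6 quad_bounded_mono[OF q]) auto
  then show ?thesis using card_cols_deletion(1)[of V 6 c 7] V by simp
qed

text \<open>The first inequality still allows 12, with equality 6 * 12 = 8 * 9. The second excludes
  it and applies because 12 + 6 is less than the 28 edges.\<close>

lemma card_cols_8:
  assumes V: "card V = 8" and q: "quad_bounded c V"
  shows "card (cols c V) \<le> 11"
proof -
  have "card (cols c (V - {v})) \<le> 9" if "v \<in> V" for v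
    using that V by (intro card_cols_7 quad_bounded_mono[OF q]) auto
  then show ?thesis
    using card_cols_deletion[of V 7 c 9] V by (simp add: choose_two)
qed

text \<open>Again the first inequality allows one colour too many: 7 * 14 = 98 \<le> 99, but 98 + 2
  > 99.\<close>

lemma card_cols_9:
  assumes V: "card V = 9" and q: "quad_bounded c V"
  shows "card (cols c V) \<le> 13"
proof -
  have "card (cols c (V - {v})) \<le> 11" if "v \<in> V" for v
    using that V by (intro card_cols_8 quad_bounded_mono[OF q]) auto
  then show ?thesis
    using card_cols_deletion[of V 8 c 11] V by (simp add: choose_two)
qed

lemma card_cols_10:
  assumes V: "card V = 10" and q: "quad_bounded c V"
  shows "card (cols c V) \<le> 16"
proof -
  have "card (cols c (V - {v})) \<le> 13" if "v \<in> V" for v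
    using that V by (intro card_cols_9 quad_bounded_mono[OF q]) auto
  then show ?thesis using card_cols_deletion(1)[of V 9 c 13] V by simp
qed

subsection \<open>Copies of small graphs\<close>

text \<open>The map in \<open>isomorphic\<close> runs from the subgraph to \<open>H\<close>; its
  inverse is the embedding \<open>g\<close>. \<open>P\<close> carries the rainbow condition for the
  diamond and is trivial for the cycles.\<close>

lemma subgraph_copy_iff:
  assumes H: "simple_graph H"
  shows "(\<exists>S. subgraph S G \<and> isomorphic S H \<and> P S) \<longleftrightarrow>
    (\<exists>g. inj_on g (verts H) \<and> g ` verts H \<subseteq> verts G \<and> (`) g ` edges H \<subseteq> edges G \<and>
         P (g ` verts H, (`) g ` edges H))" (is "?L \<longleftrightarrow> ?R")
proof
  assume ?L
  then obtain S f where S: "subgraph S G" "P S" and f: "bij_betw f (verts S) (verts H)"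
    and fe: "(`) f ` edges S = edges H"
    by (auto simp: isomorphic_def)
  define g where "g = inv_into (verts S) f"
  have g: "bij_betw g (verts H) (verts S)" unfolding g_def by (rule bij_betw_inv_into[OF f])
  have "g ` f ` e = e" if "e \<in> edges S" for e
  proof -
    have "e \<subseteq> verts S" using that S(1) by (auto simp: subgraph_def simple_graph_def nsets_def)
    then show ?thesis unfolding g_def by (rule inv_into_image_cancel[OF bij_betw_imp_inj_on[OF f]])
  qed
  then have ge: "(`) g ` edges H = edges S"
    unfolding fe[symmetric] by (force simp: image_image)
  have gv: "g ` verts H = verts S" using g by (simp add: bij_betw_def)
  have "(g ` verts H, (`) g ` edges H) = S" using ge gv by simp
  then show ?R using S g ge gv by (intro exI[of _ g]) (auto simp: bij_betw_def subgraph_def)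
next
  assume ?R
  then obtain g where g: "inj_on g (verts H)" "g ` verts H \<subseteq> verts G" "(`) g ` edges H \<subseteq> edges G"
    and P: "P (g ` verts H, (`) g ` edges H)" by blast
  let ?S = "(g ` verts H, (`) g ` edges H)"
  have eH: "e \<subseteq> verts H" "finite e" "card e = 2" if "e \<in> edges H" for e
    using that H by (auto simp: simple_graph_def nsets_def)
  have "card (g ` e) = 2" if "e \<in> edges H" for e
    using eH[OF that] inj_on_subset[OF g(1)] card_image by metis
  then have "simple_graph ?S"
    using H eH by (auto simp: simple_graph_def nsets_def)
  then have sub: "subgraph ?S G" using g by (simp add: subgraph_def)
  let ?f = "inv_into (verts H) g"
  have "bij_betw ?f (verts ?S) (verts H)"
    using bij_betw_inv_into[of g "verts H" "verts ?S"] g(1) by (simp add: bij_betw_def)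
  moreover have "(`) ?f ` edges ?S = edges H"
    using eH(1) inv_into_image_cancel[OF g(1)] by (force simp: image_image)
  ultimately have "isomorphic ?S H" unfolding isomorphic_def by blast
  then show ?L using sub P by blast
qed

lemma cycle_graph_3: "cycle_graph 3 = ({0, 1, 2}, {{0, 1}, {1, 2}, {2, 0}})"
proof -
  have "{..<3::nat} = {0, 1, 2}" by auto
  moreover have "{{i, (i + 1) mod 3} | i. i < (3::nat)} = (\<lambda>i. {i, (i + 1) mod 3}) ` {..<3}" by auto
  ultimately show ?thesis by (simp add: cycle_graph_def numeral_2_eq_2)
qed

lemma cycle_graph_4: "cycle_graph 4 = ({0, 1, 2, 3}, {{0, 1}, {1, 2}, {2, 3}, {3, 0}})"
proof -
  have "{..<4::nat} = {0, 1, 2, 3}" by auto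
  moreover have "{{i, (i + 1) mod 4} | i. i < (4::nat)} = (\<lambda>i. {i, (i + 1) mod 4}) ` {..<4}" by auto
  ultimately show ?thesis by (simp add: cycle_graph_def numeral_2_eq_2) (simp add: numeral_3_eq_3)
qed

lemma diamond_eq:
  "diamond = ({0, 1, 2, 3}, {{0, 2}, {0, 3}, {1, 2}, {1, 3}, {2, 3}})"
proof -
  have "{..<4::nat} = {0, 1, 2, 3}" by auto
  then show ?thesis
    by (simp add: diamond_def complete_graph_def nsets_2_insert insert_Diff_if doubleton_eq_iff)
       (simp only: insert_commute)
qed

lemma simple_graph_diamond: "simple_graph diamond"
  by (auto simp: simple_graph_def diamond_eq)

lemma contains_triangle_iff:
  assumes "simple_graph G"
  shows "contains_copy G (cycle_graph 3) \<longleftrightarrow>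
    (\<exists>a b c. distinct [a, b, c] \<and> {a, b} \<in> edges G \<and> {b, c} \<in> edges G \<and> {c, a} \<in> edges G)"
    (is "_ \<longleftrightarrow> ?R")
proof -
  have H: "simple_graph (cycle_graph 3)" by (auto simp: simple_graph_def cycle_graph_3)
  have v: "a \<in> verts G \<and> b \<in> verts G" if "{a, b} \<in> edges G" for a b
    using that assms by (auto simp: simple_graph_def nsets_def)
  have "contains_copy G (cycle_graph 3) \<longleftrightarrow> (\<exists>g. inj_on g {0, 1, 2::nat} \<and>
      g ` {0, 1, 2} \<subseteq> verts G \<and> (`) g ` {{0, 1}, {1, 2}, {2, 0}} \<subseteq> edges G)"
    using subgraph_copy_iff[OF H, of G "\<lambda>_. True"] by (simp add: contains_copy_def cycle_graph_3)
  also have "\<dots> \<longleftrightarrow> ?R"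
  proof
    assume "\<exists>g. inj_on g {0, 1, 2::nat} \<and> g ` {0, 1, 2} \<subseteq> verts G \<and>
      (`) g ` {{0, 1}, {1, 2}, {2, 0}} \<subseteq> edges G"
    then obtain g where "inj_on g {0, 1, 2::nat}"
      "(`) g ` {{0, 1}, {1, 2}, {2, 0}} \<subseteq> edges G"
      by (elim exE conjE) (rule that)
    then show ?R
      by (intro exI[of _ "g 0"] exI[of _ "g 1"] exI[of _ "g 2"])
         (simp add: insert_Diff_if)
  next
    assume ?R
    then obtain a b c where "distinct [a, b, c]" "{a, b} \<in> edges G" "{b, c} \<in> edges G"
      "{c, a} \<in> edges G" by blast
    then show "\<exists>g. inj_on g {0, 1, 2::nat} \<and> g ` {0, 1, 2} \<subseteq> verts G \<and>
      (`) g ` {{0, 1}, {1, 2}, {2, 0}} \<subseteq> edges G"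
      by (intro exI[of _ "\<lambda>i. [a, b, c] ! i"]) (simp add: v insert_Diff_if)
  qed
  finally show ?thesis .
qed

lemma contains_4_cycle_iff:
  assumes "simple_graph G"
  shows "contains_copy G (cycle_graph 4) \<longleftrightarrow>
    (\<exists>a b c d. distinct [a, b, c, d] \<and> {a, b} \<in> edges G \<and> {b, c} \<in> edges G \<and>
       {c, d} \<in> edges G \<and> {d, a} \<in> edges G)"
    (is "_ \<longleftrightarrow> ?R")
proof -
  have H: "simple_graph (cycle_graph 4)" by (auto simp: simple_graph_def cycle_graph_4)
  have v: "a \<in> verts G \<and> b \<in> verts G" if "{a, b} \<in> edges G" for a b
    using that assms by (auto simp: simple_graph_def nsets_def)
  have "contains_copy G (cycle_graph 4) \<longleftrightarrow> (\<exists>g. inj_on g {0, 1, 2, 3::nat} \<and>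
      g ` {0, 1, 2, 3} \<subseteq> verts G \<and> (`) g ` {{0, 1}, {1, 2}, {2, 3}, {3, 0}} \<subseteq> edges G)"
    using subgraph_copy_iff[OF H, of G "\<lambda>_. True"] by (simp add: contains_copy_def cycle_graph_4)
  also have "\<dots> \<longleftrightarrow> ?R"
  proof
    assume "\<exists>g. inj_on g {0, 1, 2, 3::nat} \<and> g ` {0, 1, 2, 3} \<subseteq> verts G \<and>
      (`) g ` {{0, 1}, {1, 2}, {2, 3}, {3, 0}} \<subseteq> edges G"
    then obtain g where "inj_on g {0, 1, 2, 3::nat}"
      "(`) g ` {{0, 1}, {1, 2}, {2, 3}, {3, 0}} \<subseteq> edges G"
      by (elim exE conjE) (rule that)
    then show ?R
      by (intro exI[of _ "g 0"] exI[of _ "g 1"] exI[of _ "g 2"] exI[of _ "g 3"])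
         (simp add: insert_Diff_if)
  next
    assume ?R
    then obtain a b c d where "distinct [a, b, c, d]" "{a, b} \<in> edges G" "{b, c} \<in> edges G"
      "{c, d} \<in> edges G" "{d, a} \<in> edges G" by (elim exE conjE) (rule that)
    then show "\<exists>g. inj_on g {0, 1, 2, 3::nat} \<and> g ` {0, 1, 2, 3} \<subseteq> verts G \<and>
      (`) g ` {{0, 1}, {1, 2}, {2, 3}, {3, 0}} \<subseteq> edges G"
      by (intro exI[of _ "\<lambda>i. [a, b, c, d] ! i"]) (simp add: v insert_Diff_if)
  qed
  finally show ?thesis .
qed

text \<open>Six edges with at least five colours have at most one coincidence, and dropping one of
  the two edges involved leaves a rainbow diamond.\<close>

lemma contains_rainbow_diamondI:
  assumes X: "X \<subseteq> {..<n}" "card X = 4" and five: "5 \<le> card (cols c X)"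
  shows "contains_rainbow_copy c (complete_graph n) diamond"
proof -
  have finX: "finite X" using X(1) finite_subset by blast
  have finE: "finite ([X]\<^bsup>2\<^esup>)" by (rule finite_imp_finite_nsets[OF finX])
  have E: "card ([X]\<^bsup>2\<^esup>) = 6" using X(2) by (simp add: choose_two)
  have "\<exists>e\<in>[X]\<^bsup>2\<^esup>. inj_on c ([X]\<^bsup>2\<^esup> - {e})"
  proof (cases "inj_on c ([X]\<^bsup>2\<^esup>)")
    case True
    then show ?thesis using E by (metis card.empty equals0I inj_on_diff zero_neq_numeral)
  next
    case False
    then obtain e f where ef: "e \<in> [X]\<^bsup>2\<^esup>" "f \<in> [X]\<^bsup>2\<^esup>" "e \<noteq> f" "c e = c f"
      by (auto simp: inj_on_def)
    \<comment> \<open>\<open>f\<close> still carries the colour of \<open>e\<close>, so five edges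
      keep all the colours, of which there are at least five.\<close>
    then have "c ` ([X]\<^bsup>2\<^esup> - {e}) = cols c X" unfolding cols_def by auto
    moreover have "card ([X]\<^bsup>2\<^esup> - {e}) = 5" using E ef(1) finE by simp
    ultimately have "inj_on c ([X]\<^bsup>2\<^esup> - {e})"
      using five finE by (metis card_image_le eq_card_imp_inj_on finite_Diff le_antisym)
    then show ?thesis using ef(1) by blast
  qed
  then obtain e where e: "e \<in> [X]\<^bsup>2\<^esup>" and inj: "inj_on c ([X]\<^bsup>2\<^esup> - {e})" by blast
  obtain a b where ab: "e = {a, b}" "a \<in> X" "b \<in> X" "a \<noteq> b" using e by (auto simp: nsets_2_eq)
  have "card (X - {a, b}) = 2" using X(2) ab finX by simp
  then obtain x y where xy: "X - {a, b} = {x, y}" "x \<noteq> y" by (auto simp: card_2_iff)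
  have Xeq: "X = {a, b, x, y}" and d: "distinct [a, b, x, y]" using xy ab by auto
  \<comment> \<open>The dropped edge \<open>{a, b}\<close> plays the part of \<open>{0, 1}\<close>,
    the edge missing from \<open>diamond\<close>, so \<open>a\<close> and \<open>b\<close> come
    first.\<close>
  let ?g = "\<lambda>i. [a, b, x, y] ! i"
  let ?F = "{{a, x}, {a, y}, {b, x}, {b, y}, {x, y}}"
  have "?F \<subseteq> [X]\<^bsup>2\<^esup> - {e}" using d Xeq ab(1) by (auto simp: doubleton_eq_iff)
  then have F: "inj_on c ?F" by (rule inj_on_subset[OF inj])
  have sub: "?F \<subseteq> edges (complete_graph n)" using X(1) Xeq d by (simp add: complete_graph_def)
  have g: "inj_on ?g (verts diamond)" using d by (simp add: diamond_eq insert_Diff_if)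
  have gv: "?g ` verts diamond = X" using Xeq by (simp add: diamond_eq)
  have ge: "(`) ?g ` edges diamond = ?F" by (simp add: diamond_eq)
  show ?thesis
    unfolding contains_rainbow_copy_def subgraph_copy_iff[OF simple_graph_diamond] rainbow_def
  proof (intro exI conjI)
    show "?g ` verts diamond \<subseteq> verts (complete_graph n)"
      using gv X(1) by (simp add: complete_graph_def)
    show "(`) ?g ` edges diamond \<subseteq> edges (complete_graph n)" unfolding ge by (rule sub)
    show "inj_on c (edges (?g ` verts diamond, (`) ?g ` edges diamond))"
      unfolding ge snd_conv by (rule F)
  qed (rule g)
qed

text \<open>\<open>a\<close> and \<open>b\<close> are the nonadjacent vertices of the diamond;
  \<open>{x, y}\<close> is the edge shared by its two triangles.\<close>

lemma contains_rainbow_diamondE: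
  assumes "contains_rainbow_copy c (complete_graph n) diamond"
  obtains a b x y where "distinct [a, b, x, y]" "a < n" "b < n" "x < n" "y < n"
    "distinct [c {a, x}, c {a, y}, c {b, x}, c {b, y}, c {x, y}]"
proof -
  obtain g where g: "inj_on g (verts diamond)" "g ` verts diamond \<subseteq> {..<n}"
    and inj: "inj_on c ((`) g ` edges diamond)"
    using assms unfolding contains_rainbow_copy_def subgraph_copy_iff[OF simple_graph_diamond] rainbow_def
    by (auto simp: complete_graph_def)
  have d: "distinct [g 0, g 1, g 2, g 3]" using g(1) by (simp add: diamond_eq insert_Diff_if)
  have ge: "(`) g ` edges diamond
      = {{g 0, g 2}, {g 0, g 3}, {g 1, g 2}, {g 1, g 3}, {g 2, g 3}}"
    by (simp add: diamond_eq)
  have "distinct [c {g 0, g 2}, c {g 0, g 3}, c {g 1, g 2}, c {g 1, g 3}, c {g 2, g 3}]"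
    using inj d unfolding ge by (simp add: insert_Diff_if doubleton_eq_iff)
  moreover have "g 0 < n" "g 1 < n" "g 2 < n" "g 3 < n" using g(2) by (simp_all add: diamond_eq)
  ultimately show ?thesis using that[OF d] by blast
qed

subsection \<open>Extremal graphs\<close>

lemma finite_edge_counts:
  "finite {card (edges G) | G :: nat graph.
      simple_graph G \<and> verts G = {..<n} \<and> (\<forall>H\<in>F. \<not> contains_copy G H)}"
proof (rule finite_subset)
  have "card (edges G) \<le> n choose 2" if "simple_graph G" "verts G = {..<n}" for G :: "nat graph"
  proof -
    have "card (edges G) \<le> card ([{..<n}]\<^bsup>2\<^esup>)"
      using that by (intro card_mono finite_imp_finite_nsets) (auto simp: simple_graph_def)
    then show ?thesis by simp
  qed
  then show "{card (edges G) | G :: nat graph.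
      simple_graph G \<and> verts G = {..<n} \<and> (\<forall>H\<in>F. \<not> contains_copy G H)} \<subseteq> {..n choose 2}"
    by auto
qed simp

lemma card_edges_le_ext:
  assumes "simple_graph G" "verts G = {..<n}" "\<And>H. H \<in> F \<Longrightarrow> \<not> contains_copy G H"
  shows "card (edges G) \<le> ext n F"
  unfolding ext_def by (rule Max_ge[OF finite_edge_counts]) (use assms in blast)

text \<open>The given \<open>G\<close> serves to make the set under \<open>Max\<close> nonempty; the
  extremal graph is \<open>G'\<close>.\<close>

lemma ext_attained:
  assumes "simple_graph G" "verts G = {..<n}" "\<And>H. H \<in> F \<Longrightarrow> \<not> contains_copy G H"
  obtains G' where "simple_graph G'" "verts G' = {..<n}" "\<And>H. H \<in> F \<Longrightarrow> \<not> contains_copy G' H"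
    "card (edges G') = ext n F"
proof -
  have "ext n F \<in> {card (edges G) | G :: nat graph.
      simple_graph G \<and> verts G = {..<n} \<and> (\<forall>H\<in>F. \<not> contains_copy G H)}"
    unfolding ext_def by (rule Max_in[OF finite_edge_counts]) (use assms in blast)
  then show ?thesis using that by force
qed

section \<open>The colouring for the lower bound\<close>

lemma rainbow_diamond_free_colouring:
  assumes n: "4 \<le> n" and G: "simple_graph G" "verts G = {..<n}"
    and C3: "\<not> contains_copy G (cycle_graph 3)" and C4: "\<not> contains_copy G (cycle_graph 4)"
  obtains c where "card (c ` edges (complete_graph n)) = card (edges G) + 1"
    "\<not> contains_rainbow_copy c (complete_graph n) diamond"
proof -
  have sub: "edges G \<subseteq> [{..<n}]\<^bsup>2\<^esup>" using G by (simp add: simple_graph_def)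
  have fin: "finite (edges G)"
    by (rule finite_subset[OF sub]) (simp add: finite_imp_finite_nsets)
  then obtain h :: "nat set \<Rightarrow> nat" where h: "inj_on h (edges G)"
    using finite_imp_inj_to_nat_seg by metis
  \<comment> \<open>Colour 0 is reserved for the nonedges of \<open>G\<close>; \<open>Suc\<close>
    keeps the other colours away from it.\<close>
  define c where "c e = (if e \<in> edges G then Suc (h e) else 0)" for e
  have tri: "\<not> ({x, y} \<in> edges G \<and> {y, z} \<in> edges G \<and> {x, z} \<in> edges G)"
    if "distinct [x, y, z]" for x y z
  proof
    assume "{x, y} \<in> edges G \<and> {y, z} \<in> edges G \<and> {x, z} \<in> edges G"
    with that have "contains_copy G (cycle_graph 3)"
      unfolding contains_triangle_iff[OF G(1)]
      by (intro exI[of _ x] exI[of _ y] exI[of _ z]) (simp add: insert_commute)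
    with C3 show False ..
  qed
  have quad: "\<not> ({w, x} \<in> edges G \<and> {x, y} \<in> edges G \<and> {y, z} \<in> edges G \<and> {w, z} \<in> edges G)"
    if "distinct [w, x, y, z]" for w x y z
  proof
    assume "{w, x} \<in> edges G \<and> {x, y} \<in> edges G \<and> {y, z} \<in> edges G \<and> {w, z} \<in> edges G"
    with that have "contains_copy G (cycle_graph 4)"
      unfolding contains_4_cycle_iff[OF G(1)]
      by (intro exI[of _ w] exI[of _ x] exI[of _ y] exI[of _ z]) (simp add: insert_commute)
    with C4 show False ..
  qed
  \<comment> \<open>Colour 0 really occurs, which gives the \<open>+ 1\<close>: if \<open>G\<close>
    were complete, 0, 1, 2 would form a triangle.\<close>
  have "[{..<n}]\<^bsup>2\<^esup> - edges G \<noteq> {}"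
  proof
    assume "[{..<n}]\<^bsup>2\<^esup> - edges G = {}"
    then have E: "{x, y} \<in> edges G" if "x < n" "y < n" "x \<noteq> y" for x y
      using that doubleton_in_nsets_2[of x y "{..<n}"] by blast
    show False using tri[of 0 1 2] E[of 0 1] E[of 1 2] E[of 0 2] n by simp
  qed
  moreover have "c ` ([{..<n}]\<^bsup>2\<^esup> - edges G) \<subseteq> {0}" by (auto simp: c_def)
  ultimately have zero: "c ` ([{..<n}]\<^bsup>2\<^esup> - edges G) = {0}"
    by (metis image_is_empty subset_singletonD)
  have pos: "c ` edges G = Suc ` h ` edges G" by (auto simp: c_def image_image)
  have "c ` edges (complete_graph n) = insert 0 (Suc ` h ` edges G)"
  proof -
    have "edges (complete_graph n) = ([{..<n}]\<^bsup>2\<^esup> - edges G) \<union> edges G"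
      using sub by (auto simp: complete_graph_def)
    then show ?thesis by (simp only: image_Un zero pos) simp
  qed
  then have "card (c ` edges (complete_graph n)) = card (edges G) + 1"
    using fin h by (simp add: card_image)
  moreover have "\<not> contains_rainbow_copy c (complete_graph n) diamond"
  proof
    assume "contains_rainbow_copy c (complete_graph n) diamond"
    then obtain a b x y where d: "distinct [a, b, x, y]"
      and dc: "distinct [c {a, x}, c {a, y}, c {b, x}, c {b, y}, c {x, y}]"
      by (rule contains_rainbow_diamondE)
    have 0: "c e = 0 \<longleftrightarrow> e \<notin> edges G" for e by (simp add: c_def)
    \<comment> \<open>At most one of the five edges has colour 0. If it is \<open>xy\<close>, the
      other four form the 4-cycle \<open>axby\<close> in \<open>G\<close>; otherwise one of the
      triangles \<open>axy\<close>, \<open>bxy\<close> lies in \<open>G\<close>.\<close>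
    show False
      using tri[of a x y] tri[of b x y] quad[of a x b y] d dc
      by (simp add: 0[symmetric] insert_commute) metis
  qed
  ultimately show ?thesis using that by blast
qed

section \<open>Induced subgraphs of the Petersen graph\<close>

text \<open>Vertices 0, ..., 4 form the outer pentagon and 5, ..., 9 the inner pentagram of the Petersen
  graph, numbered so that every initial segment of length 4, ..., 10 induces an extremal graph.\<close>

definition petersen_nbrs :: "nat list list" where
  "petersen_nbrs = [[1, 4, 5], [0, 2, 8], [1, 3, 6], [2, 4, 9], [0, 3, 7],
     [0, 6, 9], [2, 5, 7], [4, 6, 8], [1, 7, 9], [3, 5, 8]]"

text \<open>Each edge is listed from its smaller end only, so that edges can be counted by summing
  over \<open>u\<close>.\<close>

definition petersen_segment :: "nat \<Rightarrow> nat graph" where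
  "petersen_segment n = ({..<n}, (\<lambda>(u, v). {u, v}) `
     (SIGMA u:{..<n}. {v \<in> set (petersen_nbrs ! u). u < v \<and> v < n}))"

lemma simple_petersen_segment: "simple_graph (petersen_segment n)"
  by (auto simp: simple_graph_def petersen_segment_def)

text \<open>Girth at least 5, checked by evaluating all walks \<open>a\<close>, \<open>b\<close>,
  \<open>c\<close>, \<open>d\<close> that never turn straight back: neither \<open>c\<close> nor
  \<open>d\<close> is adjacent to \<open>a\<close>.\<close>

lemma petersen_girth:
  assumes "a < 10" "b \<in> set (petersen_nbrs ! a)" "c \<in> set (petersen_nbrs ! b)" "c \<noteq> a"
  shows "c \<notin> set (petersen_nbrs ! a)"
    and "d \<in> set (petersen_nbrs ! c) \<Longrightarrow> d \<noteq> b \<Longrightarrow> d \<notin> set (petersen_nbrs ! a)"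
proof -
  have *: "\<forall>a\<in>set [0..<10]. \<forall>b\<in>set (petersen_nbrs ! a). \<forall>c\<in>set (petersen_nbrs ! b). c \<noteq> a \<longrightarrow>
    c \<notin> set (petersen_nbrs ! a) \<and>
    (\<forall>d\<in>set (petersen_nbrs ! c). d \<noteq> b \<longrightarrow> d \<notin> set (petersen_nbrs ! a))"
    by code_simp
  have "a \<in> set [0..<10]" using assms(1) by simp
  from mp[OF bspec[OF bspec[OF bspec[OF * this] assms(2)] assms(3)] assms(4)]
  show "c \<notin> set (petersen_nbrs ! a)"
    and "d \<in> set (petersen_nbrs ! c) \<Longrightarrow> d \<noteq> b \<Longrightarrow> d \<notin> set (petersen_nbrs ! a)"
    by blast+
qed

text \<open>Needed to read an edge of a segment in either direction, since it is stored from one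
  end.\<close>

lemma petersen_nbrs_sym:
  assumes "u < 10" "v \<in> set (petersen_nbrs ! u)"
  shows "u \<in> set (petersen_nbrs ! v)"
proof -
  have *: "\<forall>u\<in>set [0..<10]. \<forall>v\<in>set (petersen_nbrs ! u). u \<in> set (petersen_nbrs ! v)"
    by code_simp
  have "u \<in> set [0..<10]" using assms(1) by simp
  then show ?thesis using bspec[OF bspec[OF *] assms(2)] by blast
qed

lemma petersen_segment_edgeD:
  assumes "{u, v} \<in> edges (petersen_segment n)" "n \<le> 10"
  shows "u < 10" "v \<in> set (petersen_nbrs ! u)"
proof -
  have "u < n \<and> v < n \<and> (v \<in> set (petersen_nbrs ! u) \<or> u \<in> set (petersen_nbrs ! v))"
    using assms(1) by (auto simp: petersen_segment_def doubleton_eq_iff)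
  then show "u < 10" "v \<in> set (petersen_nbrs ! u)"
    using assms(2) petersen_nbrs_sym[of v u] by auto
qed

lemma petersen_segment_free:
  assumes n: "n \<le> 10"
  shows "\<not> contains_copy (petersen_segment n) (cycle_graph 3)"
    and "\<not> contains_copy (petersen_segment n) (cycle_graph 4)"
proof -
  note D = petersen_segment_edgeD[OF _ n]
  show "\<not> contains_copy (petersen_segment n) (cycle_graph 3)"
  proof
    assume "contains_copy (petersen_segment n) (cycle_graph 3)"
    then obtain a b c where *: "distinct [a, b, c]" "{a, b} \<in> edges (petersen_segment n)"
      "{b, c} \<in> edges (petersen_segment n)" "{a, c} \<in> edges (petersen_segment n)"
      unfolding contains_triangle_iff[OF simple_petersen_segment] by (auto simp: insert_commute)
    then show False using petersen_girth(1)[of a b c] D[OF *(2)] D[OF *(3)] D[OF *(4)] by auto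
  qed
  show "\<not> contains_copy (petersen_segment n) (cycle_graph 4)"
  proof
    assume "contains_copy (petersen_segment n) (cycle_graph 4)"
    then obtain a b c d where *: "distinct [a, b, c, d]" "{a, b} \<in> edges (petersen_segment n)"
      "{b, c} \<in> edges (petersen_segment n)" "{c, d} \<in> edges (petersen_segment n)"
      "{a, d} \<in> edges (petersen_segment n)"
      unfolding contains_4_cycle_iff[OF simple_petersen_segment] by (auto simp: insert_commute)
    then show False
      using petersen_girth(2)[of a b c d] D[OF *(2)] D[OF *(3)] D[OF *(4)] D[OF *(5)] by auto
  qed
qed

lemma card_edges_petersen_segment:
  "card (edges (petersen_segment n)) =
    (\<Sum>u<n. card (set (filter (\<lambda>v. u < v \<and> v < n) (petersen_nbrs ! u))))"
proof -
  have "inj_on (\<lambda>(u, v). {u, v}) (SIGMA u:{..<n}. {v \<in> set (petersen_nbrs ! u). u < v \<and> v < n})"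
    by (auto simp: inj_on_def doubleton_eq_iff)
  then show ?thesis
    by (simp add: petersen_segment_def card_image card_SigmaI)
qed

section \<open>Comparison of the bounds and the final equality\<close>

lemma card_cols_le_petersen:
  assumes n: "4 \<le> n" "n \<le> 10" and V: "card V = n" and q: "quad_bounded c V"
  shows "card (cols c V) \<le> card (edges (petersen_segment n)) + 1"
proof -
  let ?f = "\<lambda>n. \<Sum>u\<leftarrow>[0..<n]. card (set (filter (\<lambda>v. u < v \<and> v < n) (petersen_nbrs ! u)))"
  \<comment> \<open>Each entry is one less than the bound 4, 6, 7, 9, 11, 13, 16 on the colours for
    4, ..., 10 vertices.\<close>
  have *: "map ?f [4..<11] = [3, 5, 6, 8, 10, 12, 15]"
    by code_simp
  have "n - 4 < length [4..<11]" using n by auto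
  then have "map ?f [4..<11] ! (n - 4) = ?f ([4..<11] ! (n - 4))" by (rule nth_map)
  also have "[4..<11] ! (n - 4) = n" using nth_upt[of 4 "n - 4" 11] n by linarith
  also have "?f n = card (edges (petersen_segment n))"
    unfolding card_edges_petersen_segment
    by (simp only: interv_sum_list_conv_sum_set_nat atLeast0LessThan set_upt)
  finally have E: "card (edges (petersen_segment n)) = [3, 5, 6, 8, 10, 12, 15] ! (n - 4)"
    unfolding * by (rule sym)
  consider "n = 4" | "n = 5" | "n = 6" | "n = 7" | "n = 8" | "n = 9" | "n = 10"
    using n by linarith
  then show ?thesis
  proof cases
    \<comment> \<open>On four vertices the bound is \<open>quad_bounded\<close> applied to
      \<open>V\<close> itself.\<close>
    case 1
    then show ?thesis using q V E by (simp add: quad_bounded_def)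
  qed (use E V q card_cols_5[of V c] card_cols_6[of V c] card_cols_7[of V c] card_cols_8[of V c]
    card_cols_9[of V c] card_cols_10[of V c] in simp_all)
qed

theorem theorem10:
  fixes n :: nat
  assumes "4 \<le> n" and "n \<le> 10"
  shows "rb n diamond = ext n {cycle_graph 3, cycle_graph 4} + 2"
proof -
  let ?F = "{cycle_graph 3, cycle_graph 4}"
  let ?P = "\<lambda>m. \<forall>c :: nat set \<Rightarrow> nat.
    m \<le> card (c ` edges (complete_graph n)) \<longrightarrow> contains_rainbow_copy c (complete_graph n) diamond"
  have free: "\<not> contains_copy (petersen_segment n) H" if "H \<in> ?F" for H
    using that petersen_segment_free[OF assms(2)] by blast
  have verts: "verts (petersen_segment n) = {..<n}" by (simp add: petersen_segment_def)
  \<comment> \<open>This inequality suffices for the upper bound: \<open>ext n ?F + 2\<close>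
    colours then exceed what \<open>card_cols_le_petersen\<close> allows.\<close>
  have ge: "card (edges (petersen_segment n)) \<le> ext n ?F"
    by (rule card_edges_le_ext[OF simple_petersen_segment verts free])
  have upper: "?P (ext n ?F + 2)"
  proof (intro allI impI)
    fix c :: "nat set \<Rightarrow> nat"
    assume "ext n ?F + 2 \<le> card (c ` edges (complete_graph n))"
    then have "card (edges (petersen_segment n)) + 1 < card (cols c {..<n})"
      using ge by (simp add: cols_def complete_graph_def)
    then have "\<not> quad_bounded c {..<n}"
      using card_cols_le_petersen[OF assms, of "{..<n}" c] by fastforce
    then obtain X where "X \<subseteq> {..<n}" "card X = 4" "5 \<le> card (cols c X)"
      by (auto simp: quad_bounded_def not_le Suc_le_eq[symmetric])
    then show "contains_rainbow_copy c (complete_graph n) diamond"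
      by (rule contains_rainbow_diamondI)
  qed
  obtain G where G: "simple_graph G" "verts G = {..<n}" "\<And>H. H \<in> ?F \<Longrightarrow> \<not> contains_copy G H"
    "card (edges G) = ext n ?F"
    using ext_attained[OF simple_petersen_segment verts free] by metis
  obtain c where c: "card (c ` edges (complete_graph n)) = ext n ?F + 1"
    "\<not> contains_rainbow_copy c (complete_graph n) diamond"
    using rainbow_diamond_free_colouring[OF assms(1) G(1,2)] G(3,4) by (metis insertCI)
  show ?thesis
    unfolding rb_def
  proof (rule Least_equality)
    show "?P (ext n ?F + 2)" by (rule upper)
    fix m assume "?P m"
    \<comment> \<open>\<open>c\<close> uses exactly \<open>ext n ?F + 1\<close> colours, so it
      refutes \<open>?P m\<close> for every \<open>m\<close> up to that number.\<close>
    then have "\<not> m \<le> ext n ?F + 1" using c by metis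
    then show "ext n ?F + 2 \<le> m" by linarith
  qed
qed

end
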